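(* Every labelled sequent derivable in the calculus $\mathsf{G3Xstit}$ is valid.
   Context: Fix a finite set of agents $Ag=\{1,\dots,n\}$ and a countable set $Var$ of propositional variables. $\mathcal L_{\mathsf{Xstit}}$ (negation normal form): $\phi ::= p\mid\overline p\mid\phi\wedge\phi\mid\phi\vee\phi\mid\Box\phi\mid\Diamond\phi\mid[A]^x\phi\mid\langle A\rangle^x\phi\mid[X]\phi\mid\langle X\rangle\phi$ with $p\in Var$, $A\subseteq Ag$. A relational $\mathsf{Xstit}$-model is $(W,\mathcal R_\Box,\mathcal R_X,\{\mathcal R_A\}_{A\subseteq Ag},V)$ with $W\ne\emptyset$, $V:Var\to\mathcal P(W)$ and: (D1) $\mathcal R_\Box$ is an equivalence relation; (D2) $\mathcal R_X$ is serial and deterministic; (D3) (i) $\mathcal R_\emptyset=\mathcal R_\Box\circ\mathcal R_X$; (ii) $\mathcal R_{Ag}=\mathcal R_X\circ\mathcal R_\Box$; (iii) $\mathcal R_A\subseteq\mathcal R_B$ whenever $B\subseteq A\subseteq Ag$; (iv) for all $A,B\subseteq Ag$ with $A\cap B=\emptyset$ and all $w_1,w_2,w_3,w_5,w_6$: if $\mathcal R_\Box w_1w_2$ and $\mathcal R_\Box w_1w_3$ then there is $w_4$ with $\mathcal R_\Box w_1w_4$, $(\mathcal R_Aw_4w_5\to\mathcal R_Aw_2w_5)$ and $(\mathcal R_Bw_4w_6\to\mathcal R_Bw_3w_6)$ (where $\mathcal R\circ\mathcal S=\{(w,u):\exists v(\mathcal Rwv\wedge\mathcal Svu)\}$). Satisfaction: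 $w\models p$ iff $w\in V(p)$; $w\models\overline p$ iff $w\notin V(p)$; $\wedge,\vee$ classical; $\Box/\Diamond$, $[A]^x/\langle A\rangle^x$, $[X]/\langle X\rangle$ are universal/existential quantification over $\mathcal R_\Box(w)$, $\mathcal R_A(w)$, $\mathcal R_X(w)$, with $\mathcal R(w)=\{v:(w,v)\in\mathcal R\}$. Labelled sequents of $\mathsf{G3Xstit}$: multisets of labelled formulas $x:\phi$ ($\phi\in\mathcal L_{\mathsf{Xstit}}$), relational atoms $\mathcal R_\Box xy$, $\mathcal R_Xxy$, $\mathcal R_Axy$ ($A\subseteq Ag$), and equalities $x=y$; labels from a countable set $L$. Rules ("$v$ fresh" means $v$ does not occur in the conclusion): (id) $\Gamma,w:p,w:\overline p$ is an axiom; ($\wedge$) from $\Gamma,w:\phi$ and $\Gamma,w:\psi$ infer $\Gamma,w:\phi\wedge\psi$; ($\vee$) from $\Gamma,w:\phi,w:\psi$ infer $\Gamma,w:\phi\vee\psi$; for each triple (box $\heartsuit$, diamond $\spadesuit$, relation $\mathcal R$) among ($\Box,\Diamond,\mathcal R_\Box$), ($[A]^x,\langle A\rangle^x,\mathcal R_A$), ($[X],\langle X\rangle,\mathcal R_X$): from $\Gamma,\mathcal Rwv,v:\phi$ infer $\Gamma,w:\heartsuit\phi$ ($v$ fresh) and from $\Gamma,\mathcal Rwu,w:\spadesuit\phi,u:\phi$ infer $\Gamma,\mathcal Rwu,w:\spadesuit\phi$; ($\mathsf{refl}_\Box$) from $\mathcal R_\Box ww,\Gamma$ infer $\Gamma$;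 ($\mathsf{refl}_=$) from $w=w,\Gamma$ infer $\Gamma$; ($\mathsf{eucl}_\Box$) from $\mathcal R_\Box wu,\mathcal R_\Box wv,\mathcal R_\Box uv,\Gamma$ infer $\mathcal R_\Box wu,\mathcal R_\Box wv,\Gamma$; ($\mathsf{eucl}_=$) from $w=u,w=v,u=v,\Gamma$ infer $w=u,w=v,\Gamma$; ($\mathsf{sub}_=$) from $w=u,\Delta[w],\Delta[u],\Gamma$ infer $w=u,\Delta[w],\Gamma$, where $\Delta[w]$ is a multiset of relational atoms and labelled formulas and $\Delta[u]$ replaces all occurrences of $w$ by $u$; ($\mathsf{Eff}\emptyset$) from $\mathcal R_\Box wv,\mathcal R_Xvu,\mathcal R_\emptyset wu,\Gamma$ infer $\mathcal R_\Box wv,\mathcal R_Xvu,\Gamma$; ($\emptyset\mathsf{Eff}$) from $\mathcal R_\Box wv,\mathcal R_Xvu,\mathcal R_\emptyset wu,\Gamma$ infer $\mathcal R_\emptyset wu,\Gamma$ ($v$ fresh); ($\mathsf{EffAg}$) from $\mathcal R_{Ag}wu,\mathcal R_Xwv,\mathcal R_\Box vu,\Gamma$ infer $\mathcal R_Xwv,\mathcal R_\Box vu,\Gamma$; ($\mathsf{AgEff}$) from $\mathcal R_{Ag}wu,\mathcal R_Xwv,\mathcal R_\Box vu,\Gamma$ infer $\mathcal R_{Ag}wu,\Gamma$ ($v$ fresh); ($\mathsf{C\text{-}Mon}$) for $B\subseteq A\subseteq Ag$, from $\mathcal R_Awv,\mathcal R_Bwv,\Gamma$ infer $\mathcal R_Awv,\Gamma$;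 ($\mathsf{ser}_X$) from $\mathcal R_Xwv,\Gamma$ infer $\Gamma$ ($v$ fresh); ($\mathsf{det}_X$) from $v=u,\mathcal R_Xwv,\mathcal R_Xwu,\Gamma$ infer $\mathcal R_Xwv,\mathcal R_Xwu,\Gamma$; and the system of rules ($\mathsf{IOA}_X$) for disjoint $A,B\subseteq Ag$, consisting of ($\mathsf{IOA\text{-}E}$) from $\mathcal R_\Box w_1w_2,\mathcal R_\Box w_1w_3,\mathcal R_\Box w_1w_4,\Gamma''$ infer $\mathcal R_\Box w_1w_2,\mathcal R_\Box w_1w_3,\Gamma''$ ($w_4$ fresh), ($\mathsf{IOA\text{-}U_1}$) from $\mathcal R_Aw_4w_5,\mathcal R_Aw_2w_5,\Gamma$ infer $\mathcal R_Aw_4w_5,\Gamma$, and ($\mathsf{IOA\text{-}U_2}$) from $\mathcal R_Bw_4w_6,\mathcal R_Bw_3w_6,\Gamma'$ infer $\mathcal R_Bw_4w_6,\Gamma'$; ($\mathsf{IOA\text{-}E}$) may be used freely, but ($\mathsf{IOA\text{-}U_1}$) and ($\mathsf{IOA\text{-}U_2}$) may only be used together, in separate branches, both above an instance of ($\mathsf{IOA\text{-}E}$) with the same $w_1,\dots,w_4$. The calculus also contains, for each rule where a substitution of labels duplicates active relational atoms or equalities, the instance with the duplicates contracted. Interpretation: for an $\mathsf{Xstit}$-model $M$ and $I:L\to W$ ($=$ interpreted as identity), $\Gamma$ is satisfied in $M$ under $I$ iff, whenever all relational atoms and equalities in $\Gamma$ hold of the images under $I$, some $z:\phi$ in $\Gamma$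 has $M,I(z)\models\phi$. $\Gamma$ is valid iff satisfied in every $\mathsf{Xstit}$-model under every $I$.
   Formalization: In (D3)(iv) the world w4 is chosen before, and independently of, w5 and w6; with w4 allowed to depend on w5, w6 as literally written, the derivable independence axiom ◇[1]p ∧ ◇[2]q → ◇([1]p ∧ [2]q) fails in some model, so the claim is false. *)

theory Defs
  imports Main "HOL-Library.Multiset" "HOL-Library.Sublist" "HOL-Library.Countable"
begin

text \<open>
  The agents are the elements of a type \<open>'a\<close> (of class \<open>finite\<close> in the theorem), so \<open>Ag\<close> is
  \<open>UNIV\<close> and every \<open>A :: 'a set\<close> is a group of agents.  The three kinds of accessibility
  relation index the box and diamond modalities as well as the relational atoms.
\<close>

datatype 'a rel = RBox | RX | RA "'a set"

datatype ('p, 'a) fm =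
    Pos 'p
  | Neg 'p
  | And "('p, 'a) fm" "('p, 'a) fm"
  | Or "('p, 'a) fm" "('p, 'a) fm"
  | Nec "'a rel" "('p, 'a) fm"
  | Poss "'a rel" "('p, 'a) fm"

abbreviation Box where "Box \<equiv> Nec RBox"
abbreviation Dia where "Dia \<equiv> Poss RBox"
abbreviation Choice where "Choice A \<equiv> Nec (RA A)"
abbreviation DChoice where "DChoice A \<equiv> Poss (RA A)"
abbreviation Next where "Next \<equiv> Nec RX"
abbreviation DNext where "DNext \<equiv> Poss RX"


section \<open>Relational models\<close>

record ('w, 'p, 'a) model =
  worlds :: "'w set"
  acc :: "'a rel \<Rightarrow> ('w \<times> 'w) set"
  val :: "'p \<Rightarrow> 'w set"

text \<open>
  Independence of agents.  The world \<open>w4\<close> is chosen uniformly, i.e. the two implications hold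
  at \<open>w4\<close> for all \<open>w5\<close> and \<open>w6\<close>; equivalently \<open>R\<^sub>A(w4) \<subseteq> R\<^sub>A(w2)\<close> and \<open>R\<^sub>B(w4) \<subseteq> R\<^sub>B(w3)\<close>.  If
  \<open>w4\<close> were allowed to depend on \<open>w5\<close> and \<open>w6\<close>, the axiom
  \<open>\<diamond>[A]p \<and> \<diamond>[B]q \<longrightarrow> \<diamond>([A]p \<and> [B]q)\<close>, which the calculus derives, would fail for two or more
  agents.
\<close>

definition independence :: "('w, 'p, 'a) model \<Rightarrow> bool" where
  "independence M \<longleftrightarrow>
     (\<forall>A B w1 w2 w3. A \<inter> B = {} \<longrightarrow>
        (w1, w2) \<in> acc M RBox \<longrightarrow> (w1, w3) \<in> acc M RBox \<longrightarrow>
        (\<exists>w4. (w1, w4) \<in> acc M RBox \<and>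
           (\<forall>w5. (w4, w5) \<in> acc M (RA A) \<longrightarrow> (w2, w5) \<in> acc M (RA A)) \<and>
           (\<forall>w6. (w4, w6) \<in> acc M (RA B) \<longrightarrow> (w3, w6) \<in> acc M (RA B))))"

definition xstit_model :: "('w, 'p, 'a) model \<Rightarrow> bool" where
  "xstit_model M \<longleftrightarrow>
     worlds M \<noteq> {} \<and>
     (\<forall>r. acc M r \<subseteq> worlds M \<times> worlds M) \<and>
     (\<forall>p. val M p \<subseteq> worlds M) \<and>
     equiv (worlds M) (acc M RBox) \<and>
     (\<forall>w\<in>worlds M. \<exists>v. (w, v) \<in> acc M RX) \<and>
     single_valued (acc M RX) \<and>
     acc M (RA {}) = acc M RBox O acc M RX \<and>
     acc M (RA UNIV) = acc M RX O acc M RBox \<and>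
     (\<forall>A B. B \<subseteq> A \<longrightarrow> acc M (RA A) \<subseteq> acc M (RA B)) \<and>
     independence M"

primrec sat :: "('w, 'p, 'a) model \<Rightarrow> 'w \<Rightarrow> ('p, 'a) fm \<Rightarrow> bool" where
  "sat M w (Pos p) \<longleftrightarrow> w \<in> val M p"
| "sat M w (Neg p) \<longleftrightarrow> w \<notin> val M p"
| "sat M w (And \<phi> \<psi>) \<longleftrightarrow> sat M w \<phi> \<and> sat M w \<psi>"
| "sat M w (Or \<phi> \<psi>) \<longleftrightarrow> sat M w \<phi> \<or> sat M w \<psi>"
| "sat M w (Nec r \<phi>) \<longleftrightarrow> (\<forall>v. (w, v) \<in> acc M r \<longrightarrow> sat M v \<phi>)"
| "sat M w (Poss r \<phi>) \<longleftrightarrow> (\<exists>v. (w, v) \<in> acc M r \<and> sat M v \<phi>)"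


section \<open>Labelled sequents\<close>

datatype ('p, 'a, 'l) item =
    Lab 'l "('p, 'a) fm"
  | Rel "'a rel" 'l 'l
  | Eq 'l 'l

type_synonym ('p, 'a, 'l) sequent = "('p, 'a, 'l) item multiset"

primrec item_labels :: "('p, 'a, 'l) item \<Rightarrow> 'l set" where
  "item_labels (Lab x \<phi>) = {x}"
| "item_labels (Rel r x y) = {x, y}"
| "item_labels (Eq x y) = {x, y}"

definition labels :: "('p, 'a, 'l) sequent \<Rightarrow> 'l set" where
  "labels \<Gamma> = (\<Union>i\<in>set_mset \<Gamma>. item_labels i)"

definition replace :: "'l \<Rightarrow> 'l \<Rightarrow> 'l \<Rightarrow> 'l" where
  "replace w u x = (if x = w then u else x)"

primrec item_subst :: "'l \<Rightarrow> 'l \<Rightarrow> ('p, 'a, 'l) item \<Rightarrow> ('p, 'a, 'l) item" where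
  "item_subst w u (Lab x \<phi>) = Lab (replace w u x) \<phi>"
| "item_subst w u (Rel r x y) = Rel r (replace w u x) (replace w u y)"
| "item_subst w u (Eq x y) = Eq (replace w u x) (replace w u y)"

definition subst :: "'l \<Rightarrow> 'l \<Rightarrow> ('p, 'a, 'l) sequent \<Rightarrow> ('p, 'a, 'l) sequent" where
  "subst w u \<Delta> = image_mset (item_subst w u) \<Delta>"

definition satisfied ::
  "('w, 'p, 'a) model \<Rightarrow> ('l \<Rightarrow> 'w) \<Rightarrow> ('p, 'a, 'l) sequent \<Rightarrow> bool" where
  "satisfied M I \<Gamma> \<longleftrightarrow>
     ((\<forall>r x y. Rel r x y \<in># \<Gamma> \<longrightarrow> (I x, I y) \<in> acc M r) \<and>
      (\<forall>x y. Eq x y \<in># \<Gamma> \<longrightarrow> I x = I y) \<longrightarrow>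
      (\<exists>z \<phi>. Lab z \<phi> \<in># \<Gamma> \<and> sat M (I z) \<phi>))"

text \<open>
  A definition cannot quantify over types, so the type of worlds is a parameter; a theorem about
  \<open>valid TYPE('w)\<close> with \<open>'w\<close> free speaks about models over all types of worlds.
\<close>

definition valid :: "'w itself \<Rightarrow> ('p, 'a, 'l) sequent \<Rightarrow> bool" where
  "valid _ \<Gamma> \<longleftrightarrow>
     (\<forall>(M :: ('w, 'p, 'a) model) I.
        xstit_model M \<longrightarrow> (\<forall>x. I x \<in> worlds M) \<longrightarrow> satisfied M I \<Gamma>)"


section \<open>The calculus\<close>

text \<open>
  The rules \<open>(IOA-E)\<close>, \<open>(IOA-U\<^sub>1)\<close> and \<open>(IOA-U\<^sub>2)\<close> constrain each other across a derivation.
  An inference with one of them is therefore tagged with the parameters \<open>A\<close>, \<open>B\<close>, \<open>w1\<close>, ..., \<open>w4\<close>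
  of the system of rules it belongs to; not all of them can be read off from the sequents.
\<close>

datatype ('a, 'l) tag =
    Ordinary
  | IOA_E "'a set" "'a set" 'l 'l 'l 'l
  | IOA_U1 "'a set" "'a set" 'l 'l 'l 'l
  | IOA_U2 "'a set" "'a set" 'l 'l 'l 'l

text \<open>
  \<open>inference t Ps \<Gamma>\<close>: the sequent \<open>\<Gamma>\<close> follows from the premises \<open>Ps\<close> by one rule.  The rules with
  suffix \<open>_c\<close> are the contracted instances.  In all other cases identifying labels makes an atom
  added in the premise equal to one already there, and the contracted instance would have its
  conclusion as premise.
\<close>

inductive inference ::
  "('a, 'l) tag \<Rightarrow> ('p, 'a, 'l) sequent list \<Rightarrow> ('p, 'a, 'l) sequent \<Rightarrow> bool" where
  id: "inference Ordinary [] (\<Gamma> + {#Lab w (Pos p), Lab w (Neg p)#})"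
| conj: "inference Ordinary
    [\<Gamma> + {#Lab w \<phi>#}, \<Gamma> + {#Lab w \<psi>#}]
    (\<Gamma> + {#Lab w (And \<phi> \<psi>)#})"
| disj: "inference Ordinary
    [\<Gamma> + {#Lab w \<phi>, Lab w \<psi>#}]
    (\<Gamma> + {#Lab w (Or \<phi> \<psi>)#})"
| nec: "v \<notin> labels (\<Gamma> + {#Lab w (Nec r \<phi>)#}) \<Longrightarrow> inference Ordinary
    [\<Gamma> + {#Rel r w v, Lab v \<phi>#}]
    (\<Gamma> + {#Lab w (Nec r \<phi>)#})"
| poss: "inference Ordinary
    [\<Gamma> + {#Rel r w u, Lab w (Poss r \<phi>), Lab u \<phi>#}]
    (\<Gamma> + {#Rel r w u, Lab w (Poss r \<phi>)#})"
| refl_box: "inference Ordinary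
    [{#Rel RBox w w#} + \<Gamma>]
    \<Gamma>"
| refl_eq: "inference Ordinary
    [{#Eq w w#} + \<Gamma>]
    \<Gamma>"
| eucl_box: "inference Ordinary
    [{#Rel RBox w u, Rel RBox w v, Rel RBox u v#} + \<Gamma>]
    ({#Rel RBox w u, Rel RBox w v#} + \<Gamma>)"
| eucl_box_c: "inference Ordinary
    [{#Rel RBox w u, Rel RBox u u#} + \<Gamma>]
    ({#Rel RBox w u#} + \<Gamma>)"
| eucl_eq: "inference Ordinary
    [{#Eq w u, Eq w v, Eq u v#} + \<Gamma>]
    ({#Eq w u, Eq w v#} + \<Gamma>)"
| eucl_eq_c: "inference Ordinary
    [{#Eq w u, Eq u u#} + \<Gamma>]
    ({#Eq w u#} + \<Gamma>)"
| sub_eq: "(\<And>x y. Eq x y \<notin># \<Delta>) \<Longrightarrow> inference Ordinary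
    [{#Eq w u#} + \<Delta> + subst w u \<Delta> + \<Gamma>]
    ({#Eq w u#} + \<Delta> + \<Gamma>)"
| Eff_empty: "inference Ordinary
    [{#Rel RBox w v, Rel RX v u, Rel (RA {}) w u#} + \<Gamma>]
    ({#Rel RBox w v, Rel RX v u#} + \<Gamma>)"
| empty_Eff: "v \<notin> labels ({#Rel (RA {}) w u#} + \<Gamma>) \<Longrightarrow> inference Ordinary
    [{#Rel RBox w v, Rel RX v u, Rel (RA {}) w u#} + \<Gamma>]
    ({#Rel (RA {}) w u#} + \<Gamma>)"
| Eff_Ag: "inference Ordinary
    [{#Rel (RA UNIV) w u, Rel RX w v, Rel RBox v u#} + \<Gamma>]
    ({#Rel RX w v, Rel RBox v u#} + \<Gamma>)"
| Ag_Eff: "v \<notin> labels ({#Rel (RA UNIV) w u#} + \<Gamma>) \<Longrightarrow> inference Ordinary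
    [{#Rel (RA UNIV) w u, Rel RX w v, Rel RBox v u#} + \<Gamma>]
    ({#Rel (RA UNIV) w u#} + \<Gamma>)"
| C_Mon: "B \<subseteq> A \<Longrightarrow> inference Ordinary
    [{#Rel (RA A) w v, Rel (RA B) w v#} + \<Gamma>]
    ({#Rel (RA A) w v#} + \<Gamma>)"
| ser_X: "v \<notin> labels \<Gamma> \<Longrightarrow> inference Ordinary
    [{#Rel RX w v#} + \<Gamma>]
    \<Gamma>"
| det_X: "inference Ordinary
    [{#Eq v u, Rel RX w v, Rel RX w u#} + \<Gamma>]
    ({#Rel RX w v, Rel RX w u#} + \<Gamma>)"
| det_X_c: "inference Ordinary
    [{#Eq v v, Rel RX w v#} + \<Gamma>]
    ({#Rel RX w v#} + \<Gamma>)"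
| IOA_E: "A \<inter> B = {} \<Longrightarrow> w4 \<notin> labels ({#Rel RBox w1 w2, Rel RBox w1 w3#} + \<Gamma>) \<Longrightarrow>
    inference (IOA_E A B w1 w2 w3 w4)
    [{#Rel RBox w1 w2, Rel RBox w1 w3, Rel RBox w1 w4#} + \<Gamma>]
    ({#Rel RBox w1 w2, Rel RBox w1 w3#} + \<Gamma>)"
| IOA_E_c: "A \<inter> B = {} \<Longrightarrow> w4 \<notin> labels ({#Rel RBox w1 w2#} + \<Gamma>) \<Longrightarrow>
    inference (IOA_E A B w1 w2 w2 w4)
    [{#Rel RBox w1 w2, Rel RBox w1 w4#} + \<Gamma>]
    ({#Rel RBox w1 w2#} + \<Gamma>)"
| IOA_U1: "A \<inter> B = {} \<Longrightarrow> inference (IOA_U1 A B w1 w2 w3 w4)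
    [{#Rel (RA A) w4 w5, Rel (RA A) w2 w5#} + \<Gamma>]
    ({#Rel (RA A) w4 w5#} + \<Gamma>)"
| IOA_U2: "A \<inter> B = {} \<Longrightarrow> inference (IOA_U2 A B w1 w2 w3 w4)
    [{#Rel (RA B) w4 w6, Rel (RA B) w3 w6#} + \<Gamma>]
    ({#Rel (RA B) w4 w6#} + \<Gamma>)"

datatype ('p, 'a, 'l) tree =
  Node (tag_of: "('a, 'l) tag") (concl: "('p, 'a, 'l) sequent") (prems: "('p, 'a, 'l) tree list")

fun locally_correct :: "('p, 'a, 'l) tree \<Rightarrow> bool" where
  "locally_correct (Node t \<Gamma> ts) \<longleftrightarrow>
     inference t (map concl ts) \<Gamma> \<and> (\<forall>s\<in>set ts. locally_correct s)"

text \<open>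
  \<open>occurs T \<pi> t\<close>: the inference at position \<open>\<pi>\<close> of \<open>T\<close> has tag \<open>t\<close>.  A position is the path from
  the root (the endsequent), so \<open>\<pi>\<close> is above \<open>\<rho>\<close> iff \<open>\<rho>\<close> is a strict prefix of \<open>\<pi>\<close>, and parallel
  positions are those in separate branches.
\<close>

fun occurs :: "('p, 'a, 'l) tree \<Rightarrow> nat list \<Rightarrow> ('a, 'l) tag \<Rightarrow> bool" where
  "occurs (Node s \<Gamma> ts) [] t \<longleftrightarrow> s = t"
| "occurs (Node s \<Gamma> ts) (i # \<pi>) t \<longleftrightarrow> i < length ts \<and> occurs (ts ! i) \<pi> t"

definition IOA_linked ::
  "('p, 'a, 'l) tree \<Rightarrow> 'a set \<Rightarrow> 'a set \<Rightarrow> 'l \<Rightarrow> 'l \<Rightarrow> 'l \<Rightarrow> 'l \<Rightarrow> nat list \<Rightarrow> nat list \<Rightarrow> bool" where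
  "IOA_linked T A B w1 w2 w3 w4 \<pi> \<sigma> \<longleftrightarrow>
     occurs T \<pi> (IOA_U1 A B w1 w2 w3 w4) \<and>
     occurs T \<sigma> (IOA_U2 A B w1 w2 w3 w4) \<and>
     \<pi> \<parallel> \<sigma> \<and>
     (\<exists>\<rho>. occurs T \<rho> (IOA_E A B w1 w2 w3 w4) \<and> strict_prefix \<rho> \<pi> \<and> strict_prefix \<rho> \<sigma>)"

definition IOA_condition :: "('p, 'a, 'l) tree \<Rightarrow> bool" where
  "IOA_condition T \<longleftrightarrow>
     (\<forall>A B w1 w2 w3 w4.
        (\<forall>\<pi>. occurs T \<pi> (IOA_U1 A B w1 w2 w3 w4) \<longrightarrow>
           (\<exists>\<sigma>. IOA_linked T A B w1 w2 w3 w4 \<pi> \<sigma>)) \<and>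
        (\<forall>\<sigma>. occurs T \<sigma> (IOA_U2 A B w1 w2 w3 w4) \<longrightarrow>
           (\<exists>\<pi>. IOA_linked T A B w1 w2 w3 w4 \<pi> \<sigma>)))"

definition derivable :: "('p, 'a, 'l) sequent \<Rightarrow> bool" where
  "derivable \<Gamma> \<longleftrightarrow> (\<exists>T. locally_correct T \<and> IOA_condition T \<and> concl T = \<Gamma>)"

end

theory Submission
  imports Defs
begin

text \<open>
  A countermodel of the endsequent is pushed upwards through the derivation, the interpretation
  being changed at the fresh labels only.  Labels never disappear on the way up.  Hence the world
  chosen for \<open>w4\<close> at an instance of \<open>(IOA-E)\<close> still witnesses independence of the worlds of \<open>w2\<close>
  and \<open>w3\<close> at every instance of \<open>(IOA-U\<^sub>1)\<close> and \<open>(IOA-U\<^sub>2)\<close> above it.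

  The rule \<open>(ser\<^sub>X)\<close> as encoded admits \<open>w = v\<close>: it then introduces an atom \<open>R\<^sub>X v v\<close> with \<open>v\<close>
  fresh, which need not be satisfiable in a given model.  So the countermodel is first extended
  by an isolated point at which all relations loop; this does not affect truth in the old worlds.
\<close>

section \<open>Refutation of sequents in a model\<close>

text \<open>Atoms must hold and labelled formulas must fail, so a countermodel becomes a condition
  on each item separately that distributes over multiset union.\<close>

primrec refuted :: "('w, 'p, 'a) model \<Rightarrow> ('l \<Rightarrow> 'w) \<Rightarrow> ('p, 'a, 'l) item \<Rightarrow> bool" where
  "refuted M I (Lab x \<phi>) \<longleftrightarrow> \<not> sat M (I x) \<phi>"
| "refuted M I (Rel r x y) \<longleftrightarrow> (I x, I y) \<in> acc M r"
| "refuted M I (Eq x y) \<longleftrightarrow> I x = I y"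

definition refutes :: "('w, 'p, 'a) model \<Rightarrow> ('l \<Rightarrow> 'w) \<Rightarrow> ('p, 'a, 'l) sequent \<Rightarrow> bool" where
  "refutes M I \<Gamma> \<longleftrightarrow> (\<forall>i\<in>#\<Gamma>. refuted M I i)"

lemma satisfied_iff_not_refutes: "satisfied M I \<Gamma> \<longleftrightarrow> \<not> refutes M I \<Gamma>"
proof
  assume "satisfied M I \<Gamma>"
  then show "\<not> refutes M I \<Gamma>"
    unfolding satisfied_def refutes_def by fastforce
next
  assume "\<not> refutes M I \<Gamma>"
  then obtain i where i: "i \<in># \<Gamma>" "\<not> refuted M I i"
    unfolding refutes_def by blast
  then show "satisfied M I \<Gamma>"
    unfolding satisfied_def by (cases i) auto
qed

lemma refutes_empty [simp]: "refutes M I {#}"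
  and refutes_union [simp]: "refutes M I (\<Gamma> + \<Delta>) \<longleftrightarrow> refutes M I \<Gamma> \<and> refutes M I \<Delta>"
  and refutes_add [simp]: "refutes M I (add_mset i \<Gamma>) \<longleftrightarrow> refuted M I i \<and> refutes M I \<Gamma>"
  by (auto simp: refutes_def)

lemma labels_empty [simp]: "labels {#} = {}"
  and labels_union [simp]: "labels (\<Gamma> + \<Delta>) = labels \<Gamma> \<union> labels \<Delta>"
  and labels_add [simp]: "labels (add_mset i \<Gamma>) = item_labels i \<union> labels \<Gamma>"
  by (auto simp: labels_def)

lemma refuted_cong:
  assumes "\<And>x. x \<in> item_labels i \<Longrightarrow> I x = J x"
  shows "refuted M I i \<longleftrightarrow> refuted M J i"
  using assms by (cases i) auto

lemma refutes_cong:
  assumes "\<And>x. x \<in> labels \<Gamma> \<Longrightarrow> I x = J x"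
  shows "refutes M I \<Gamma> \<longleftrightarrow> refutes M J \<Gamma>"
  using assms refuted_cong[of _ I J M] unfolding refutes_def labels_def by blast

lemma refutes_upd [simp]:
  "v \<notin> labels \<Gamma> \<Longrightarrow> refutes M (I(v := a)) \<Gamma> \<longleftrightarrow> refutes M I \<Gamma>"
  by (rule refutes_cong) auto

lemma refutes_subst:
  assumes "I w = I u"
  shows "refutes M I (subst w u \<Delta>) \<longleftrightarrow> refutes M I \<Delta>"
proof -
  have "refuted M I (item_subst w u i) \<longleftrightarrow> refuted M I i" for i
    using assms by (cases i) (auto simp: replace_def)
  then show ?thesis by (auto simp: refutes_def subst_def)
qed

section \<open>Independence witnesses and the tags that refer to them\<close>

definition independence_witness ::
  "('w, 'p, 'a) model \<Rightarrow> 'a set \<Rightarrow> 'a set \<Rightarrow> 'w \<Rightarrow> 'w \<Rightarrow> 'w \<Rightarrow> bool" where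
  "independence_witness M A B w2 w3 w4 \<longleftrightarrow>
     (\<forall>w5. (w4, w5) \<in> acc M (RA A) \<longrightarrow> (w2, w5) \<in> acc M (RA A)) \<and>
     (\<forall>w6. (w4, w6) \<in> acc M (RA B) \<longrightarrow> (w3, w6) \<in> acc M (RA B))"

lemma independenceE:
  assumes "independence M" "A \<inter> B = {}"
    and "(w1, w2) \<in> acc M RBox" "(w1, w3) \<in> acc M RBox"
  obtains w4 where "(w1, w4) \<in> acc M RBox" "independence_witness M A B w2 w3 w4"
  using assms(1)[unfolded independence_def, rule_format, OF assms(2-4)]
  unfolding independence_witness_def by blast

text \<open>The three tags of one system of rules carry the same condition, so what
  \<open>IOA_E\<close> establishes can be read off directly at \<open>IOA_U1\<close> and
  \<open>IOA_U2\<close>.\<close>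

primrec tag_holds :: "('w, 'p, 'a) model \<Rightarrow> ('l \<Rightarrow> 'w) \<Rightarrow> ('a, 'l) tag \<Rightarrow> bool" where
  "tag_holds M I Ordinary \<longleftrightarrow> True"
| "tag_holds M I (IOA_E A B w1 w2 w3 w4) \<longleftrightarrow> independence_witness M A B (I w2) (I w3) (I w4)"
| "tag_holds M I (IOA_U1 A B w1 w2 w3 w4) \<longleftrightarrow> independence_witness M A B (I w2) (I w3) (I w4)"
| "tag_holds M I (IOA_U2 A B w1 w2 w3 w4) \<longleftrightarrow> independence_witness M A B (I w2) (I w3) (I w4)"

primrec IOA_E_of :: "('a, 'l) tag \<Rightarrow> ('a, 'l) tag" where
  "IOA_E_of Ordinary = Ordinary"
| "IOA_E_of (IOA_E A B w1 w2 w3 w4) = IOA_E A B w1 w2 w3 w4"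
| "IOA_E_of (IOA_U1 A B w1 w2 w3 w4) = IOA_E A B w1 w2 w3 w4"
| "IOA_E_of (IOA_U2 A B w1 w2 w3 w4) = IOA_E A B w1 w2 w3 w4"

primrec is_IOA_U :: "('a, 'l) tag \<Rightarrow> bool" where
  "is_IOA_U Ordinary = False"
| "is_IOA_U (IOA_E A B w1 w2 w3 w4) = False"
| "is_IOA_U (IOA_U1 A B w1 w2 w3 w4) = True"
| "is_IOA_U (IOA_U2 A B w1 w2 w3 w4) = True"

text \<open>Nonempty only for \<open>IOA_E\<close>, where the sequent itself forces these labels to
  occur; a premise of \<open>IOA_U1\<close> need not contain \<open>w3\<close>, nor one of
  \<open>IOA_U2\<close> the label \<open>w2\<close>.\<close>

primrec IOA_E_labels :: "('a, 'l) tag \<Rightarrow> 'l set" where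
  "IOA_E_labels Ordinary = {}"
| "IOA_E_labels (IOA_E A B w1 w2 w3 w4) = {w2, w3, w4}"
| "IOA_E_labels (IOA_U1 A B w1 w2 w3 w4) = {}"
| "IOA_E_labels (IOA_U2 A B w1 w2 w3 w4) = {}"

text \<open>Ensures that a label chosen fresh further up differs from the \<open>w2\<close>,
  \<open>w3\<close>, \<open>w4\<close> of every \<open>IOA_E\<close> below it.\<close>

lemma inference_labels:
  assumes "inference t Ps \<Gamma>" "P \<in> set Ps"
  shows "labels \<Gamma> \<union> IOA_E_labels t \<subseteq> labels P"
  using assms by (induction rule: inference.induct) auto

lemma xstit_modelD:
  assumes "xstit_model M"
  shows "\<forall>r. acc M r \<subseteq> worlds M \<times> worlds M"
    and "\<forall>p. val M p \<subseteq> worlds M"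
    and "equiv (worlds M) (acc M RBox)"
    and "\<forall>w\<in>worlds M. \<exists>v. (w, v) \<in> acc M RX"
    and "single_valued (acc M RX)"
    and "acc M (RA {}) = acc M RBox O acc M RX"
    and "acc M (RA UNIV) = acc M RX O acc M RBox"
    and "\<forall>A B. B \<subseteq> A \<longrightarrow> acc M (RA A) \<subseteq> acc M (RA B)"
    and "independence M"
  using assms[unfolded xstit_model_def] by - (elim conjE; assumption)+

text \<open>For most relational rules, the matching frame condition makes the added atoms true. For
  \<open>IOA_U1\<close> and \<open>IOA_U2\<close> the sequent does not link \<open>w4\<close> to
  \<open>w2\<close> or \<open>w3\<close>, so assumption \<open>U\<close> supplies the witness; the
  \<open>IOA_E\<close> cases create it.\<close>

lemma inference_refutes:
  assumes inf: "inference t Ps \<Gamma>"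
    and M: "xstit_model M"
    and loop: "(l, l) \<in> acc M RX"
    and I: "\<And>x. I x \<in> worlds M"
    and U: "is_IOA_U t \<Longrightarrow> tag_holds M I t"
    and ref: "refutes M I \<Gamma>"
  shows "\<exists>P\<in>set Ps. \<exists>J. (\<forall>x. J x \<in> worlds M) \<and> (\<forall>x\<in>labels \<Gamma>. J x = I x) \<and>
           refutes M J P \<and> tag_holds M J t"
proof -
  note eqv = xstit_modelD(3)[OF M] and det = xstit_modelD(5)[OF M]
    and empty = xstit_modelD(6)[OF M] and Ag = xstit_modelD(7)[OF M]
    and mono = xstit_modelD(8)[OF M, rule_format] and ind = xstit_modelD(9)[OF M]
  have W: "\<And>r a b. (a, b) \<in> acc M r \<Longrightarrow> a \<in> worlds M \<and> b \<in> worlds M"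
    using xstit_modelD(1)[OF M] by auto
  have ser: "\<And>w. w \<in> worlds M \<Longrightarrow> \<exists>v. (w, v) \<in> acc M RX"
    using xstit_modelD(4)[OF M] by auto
  have refl: "\<And>w. w \<in> worlds M \<Longrightarrow> (w, w) \<in> acc M RBox"
    using eqv by (meson equivE refl_onD)
  have eucl: "\<And>a b c. (a, b) \<in> acc M RBox \<Longrightarrow> (a, c) \<in> acc M RBox \<Longrightarrow> (b, c) \<in> acc M RBox"
    using eqv by (meson equivE symD transD)
  have same: ?thesis
    if "\<exists>P\<in>set Ps. refutes M I P" "tag_holds M I t"
    using that I by blast
  \<comment> \<open>Shared by all rules with a fresh label: only \<open>v\<close> is
    reinterpreted.\<close>
  have fresh: ?thesis
    if "\<exists>P\<in>set Ps. refutes M (I(v := a)) P" "v \<notin> labels \<Gamma>" "a \<in> worlds M"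
      "tag_holds M (I(v := a)) t" for v a
  proof -
    have "\<forall>x. (I(v := a)) x \<in> worlds M" "\<forall>x\<in>labels \<Gamma>. (I(v := a)) x = I x"
      using that I by auto
    with that show ?thesis by blast
  qed
  from inf show ?thesis
  proof cases
    case (id \<Delta> w p)
    then show ?thesis using ref by auto
  next
    case (conj \<Delta> w \<phi> \<psi>)
    then show ?thesis using ref by (intro same) auto
  next
    case (nec v \<Delta> w r \<phi>)
    then obtain a where a: "(I w, a) \<in> acc M r" "\<not> sat M a \<phi>" using ref by auto
    show ?thesis
      by (rule fresh[of v a]) (use nec a ref W[OF a(1)] in auto)
  next
    case (sub_eq \<Delta> w u \<Theta>)
    then have "I w = I u" using ref by simp
    then show ?thesis using sub_eq ref by (intro same) (auto simp: refutes_subst)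
  next
    case (empty_Eff v w u \<Delta>)
    then obtain a where a: "(I w, a) \<in> acc M RBox" "(a, I u) \<in> acc M RX"
      using ref empty by auto
    show ?thesis
      by (rule fresh[of v a]) (use empty_Eff a ref W[OF a(1)] in auto)
  next
    case (Ag_Eff v w u \<Delta>)
    then obtain a where a: "(I w, a) \<in> acc M RX" "(a, I u) \<in> acc M RBox"
      using ref Ag by auto
    show ?thesis
      by (rule fresh[of v a]) (use Ag_Eff a ref W[OF a(1)] in auto)
  next
    case (ser_X v w)
    show ?thesis
    proof (cases "w = v")
      \<comment> \<open>The new atom relates \<open>v\<close> to itself, so \<open>v\<close> is sent
        to the looping world \<open>l\<close>.\<close>
      case True
      show ?thesis
        by (rule fresh[of v l]) (use ser_X True loop ref W[OF loop] in auto)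
    next
      case False
      obtain a where a: "(I w, a) \<in> acc M RX" using ser I by blast
      show ?thesis
        by (rule fresh[of v a]) (use ser_X False a ref W[OF a] in auto)
    qed
  next
    case (det_X v u w \<Delta>)
    then have "I v = I u" using ref det by (auto dest: single_valuedD)
    then show ?thesis using det_X ref by (intro same) auto
  next
    case (IOA_E A B w4 w1 w2 w3 \<Delta>)
    then have "(I w1, I w2) \<in> acc M RBox" "(I w1, I w3) \<in> acc M RBox" using ref by auto
    with ind \<open>A \<inter> B = {}\<close> obtain a
      where a: "(I w1, a) \<in> acc M RBox" "independence_witness M A B (I w2) (I w3) a"
      by (rule independenceE)
    show ?thesis
      by (rule fresh[of w4 a]) (use IOA_E a ref W[OF a(1)] in auto)
  next
    case (IOA_E_c A B w4 w1 w2 \<Delta>)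
    then have "(I w1, I w2) \<in> acc M RBox" using ref by auto
    then obtain a
      where a: "(I w1, a) \<in> acc M RBox" "independence_witness M A B (I w2) (I w2) a"
      using independenceE[OF ind \<open>A \<inter> B = {}\<close>] by blast
    show ?thesis
      by (rule fresh[of w4 a]) (use IOA_E_c a ref W[OF a(1)] in auto)
  next
    case IOA_U1
    then show ?thesis using ref U by (intro same) (auto simp: independence_witness_def)
  next
    case IOA_U2
    then show ?thesis using ref U by (intro same) (auto simp: independence_witness_def)
  next
    case (C_Mon B A w v \<Delta>)
    then show ?thesis using ref mono[of B A] by (intro same) auto
  next
    case (eucl_box w u v \<Delta>)
    then have "(I u, I v) \<in> acc M RBox" using ref eucl[of "I w" "I u" "I v"] by simp
    then show ?thesis using eucl_box ref by (intro same) auto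
  next
    case (eucl_box_c w u \<Delta>)
    then show ?thesis using ref refl[OF I] by (intro same) auto
  \<comment> \<open>In the remaining rules \<open>I\<close> itself refutes the premise.\<close>
  qed (use ref in \<open>(intro same; auto simp: empty Ag refl[OF I])+\<close>)
qed

section \<open>Induction over derivations\<close>

lemma tag_holds_cong:
  assumes "\<And>x. x \<in> IOA_E_labels (IOA_E_of t) \<Longrightarrow> I x = J x"
  shows "tag_holds M I t \<longleftrightarrow> tag_holds M J t"
  using assms by (cases t) auto

text \<open>The set \<open>S\<close> collects the tags of the inferences below the subtree \<open>T\<close>.\<close>

lemma locally_correct_not_refutes:
  assumes M: "xstit_model M"
    and loop: "(l, l) \<in> acc M RX"
  shows "locally_correct T \<Longrightarrow>
    (\<And>\<pi> t. occurs T \<pi> t \<Longrightarrow> is_IOA_U t \<Longrightarrow>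
       IOA_E_of t \<in> S \<or> (\<exists>\<rho>. strict_prefix \<rho> \<pi> \<and> occurs T \<rho> (IOA_E_of t))) \<Longrightarrow>
    (\<And>t. t \<in> S \<Longrightarrow> IOA_E_labels t \<subseteq> labels (concl T)) \<Longrightarrow>
    (\<And>t. t \<in> S \<Longrightarrow> IOA_E_of t = t \<Longrightarrow> tag_holds M I t) \<Longrightarrow>
    (\<And>x. I x \<in> worlds M) \<Longrightarrow> \<not> refutes M I (concl T)"
proof (induction T arbitrary: S I)
  case (Node t \<Gamma> ts)
  have inf: "inference t (map concl ts) \<Gamma>" using Node.prems(1) by simp
  have U: "tag_holds M I t" if "is_IOA_U t"
  proof -
    \<comment> \<open>The root position \<open>[]\<close> has no strict prefix, so the matching
      \<open>IOA_E\<close> lies below the subtree.\<close>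
    have "IOA_E_of t \<in> S" using Node.prems(2)[of "[]" t] that by simp
    moreover have "IOA_E_of (IOA_E_of t) = IOA_E_of t" by (cases t) auto
    ultimately have "tag_holds M I (IOA_E_of t)" using Node.prems(4) by metis
    then show ?thesis by (cases t) auto
  qed
  show ?case
  proof
    assume "refutes M I (concl (Node t \<Gamma> ts))"
    then have "refutes M I \<Gamma>" by simp
    from inference_refutes[OF inf M loop Node.prems(5) U this]
    obtain s J where s: "s \<in> set ts" and J: "\<And>x. J x \<in> worlds M"
      and JI: "\<And>x. x \<in> labels \<Gamma> \<Longrightarrow> J x = I x"
      and ref: "refutes M J (concl s)" and t: "tag_holds M J t"
      by auto
    have lab: "labels \<Gamma> \<union> IOA_E_labels t \<subseteq> labels (concl s)"
      using inference_labels[OF inf] s by simp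
    have "\<not> refutes M J (concl s)"
    \<comment> \<open>Seen from the subtree \<open>s\<close>, the current inference has joined those
      below.\<close>
    proof (rule Node.IH[OF s, of "insert t S"])
      show "locally_correct s" using Node.prems(1) s by simp
    next
      fix \<pi> u assume u: "occurs s \<pi> u" "is_IOA_U u"
      obtain i where i: "i < length ts" "ts ! i = s" using s by (meson in_set_conv_nth)
      consider "IOA_E_of u \<in> S"
        | \<rho> where "strict_prefix \<rho> (i # \<pi>)" "occurs (Node t \<Gamma> ts) \<rho> (IOA_E_of u)"
        using Node.prems(2)[of "i # \<pi>" u] u i by auto
      then show "IOA_E_of u \<in> insert t S \<or>
          (\<exists>\<rho>. strict_prefix \<rho> \<pi> \<and> occurs s \<rho> (IOA_E_of u))"
      proof cases
        \<comment> \<open>If \<open>\<rho>\<close> is empty, the matching \<open>IOA_E\<close> is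
          the current tag \<open>t\<close>; otherwise it lies inside \<open>s\<close>, at the tail
          of \<open>\<rho>\<close>.\<close>
        case 2
        then show ?thesis using i by (cases \<rho>) auto
      qed auto
    next
      fix u assume "u \<in> insert t S"
      then show "IOA_E_labels u \<subseteq> labels (concl s)"
        using lab Node.prems(3)[of u] by auto
    next
      fix u assume u: "u \<in> insert t S" "IOA_E_of u = u"
      show "tag_holds M J u"
      \<comment> \<open>The tag \<open>t\<close> holds under \<open>J\<close> by the choice of
        \<open>J\<close>. An older tag transfers from \<open>I\<close>, since its labels occur in
        \<open>\<Gamma>\<close>; the restriction \<open>IOA_E_of u = u\<close> leaves out
        \<open>U\<close> tags, whose \<open>IOA_E_labels\<close> is empty.\<close>
      proof (cases "u = t")
        case False
        then have "u \<in> S" using u by simp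
        moreover from this have "tag_holds M J u \<longleftrightarrow> tag_holds M I u"
          using Node.prems(3)[of u] JI u(2) by (intro tag_holds_cong) auto
        ultimately show ?thesis using Node.prems(4) u by blast
      qed (use t in simp)
    qed (rule J)
    with ref show False by contradiction
  qed
qed

section \<open>Adding an isolated looping point\<close>

definition add_loop :: "('w, 'p, 'a) model \<Rightarrow> ('w option, 'p, 'a) model" where
  "add_loop M =
     \<lparr>worlds = insert None (Some ` worlds M),
      acc = \<lambda>r. insert (None, None) (map_prod Some Some ` acc M r),
      val = \<lambda>p. Some ` val M p\<rparr>"

lemma acc_add_loop [simp]:
  "(Some a, Some b) \<in> acc (add_loop M) r \<longleftrightarrow> (a, b) \<in> acc M r"
  "(None, None) \<in> acc (add_loop M) r"
  "(Some a, None) \<notin> acc (add_loop M) r"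
  "(None, Some b) \<notin> acc (add_loop M) r"
  by (auto simp: add_loop_def)

lemma worlds_add_loop [simp]:
  "Some a \<in> worlds (add_loop M) \<longleftrightarrow> a \<in> worlds M"
  "None \<in> worlds (add_loop M)"
  by (auto simp: add_loop_def)

text \<open>No relation leaves the copy of \<open>M\<close>, which is thus a generated
  submodel.\<close>

lemma sat_add_loop: "sat (add_loop M) (Some w) \<phi> \<longleftrightarrow> sat M w \<phi>"
proof (induction \<phi> arbitrary: w)
  case (Pos p)
  then show ?case by (auto simp: add_loop_def)
next
  case (Neg p)
  then show ?case by (auto simp: add_loop_def)
qed (auto simp: split_option_all split_option_ex)

lemma refutes_add_loop: "refutes (add_loop M) (Some \<circ> I) \<Gamma> \<longleftrightarrow> refutes M I \<Gamma>"
proof -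
  have "refuted (add_loop M) (Some \<circ> I) i \<longleftrightarrow> refuted M I i" for i
    by (cases i) (auto simp: sat_add_loop)
  then show ?thesis by (simp add: refutes_def)
qed

text \<open>A box class is either \<open>{None}\<close>, where \<open>None\<close> is its own
  witness, or the copy of a class of \<open>M\<close>, where the old witness serves.\<close>

lemma independence_add_loop:
  fixes M :: "('w, 'p, 'a) model"
  assumes "independence M"
  shows "independence (add_loop M)"
  unfolding independence_def
proof (intro allI impI)
  fix A B :: "'a set" and w1 w2 w3
  assume *: "A \<inter> B = {}" "(w1, w2) \<in> acc (add_loop M) RBox" "(w1, w3) \<in> acc (add_loop M) RBox"
  show "\<exists>w4. (w1, w4) \<in> acc (add_loop M) RBox \<and>
      (\<forall>w5. (w4, w5) \<in> acc (add_loop M) (RA A) \<longrightarrow> (w2, w5) \<in> acc (add_loop M) (RA A)) \<and>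
      (\<forall>w6. (w4, w6) \<in> acc (add_loop M) (RA B) \<longrightarrow> (w3, w6) \<in> acc (add_loop M) (RA B))"
  proof (cases w1)
    case None
    with * have "w2 = None" "w3 = None" by (cases w2; cases w3; simp)+
    with None show ?thesis by (intro exI[of _ None]) simp
  next
    case (Some a)
    with * obtain b c where bc: "w2 = Some b" "w3 = Some c" by (cases w2; cases w3; simp)
    with * Some have "(a, b) \<in> acc M RBox" "(a, c) \<in> acc M RBox" by simp_all
    with assms *(1) obtain d where "(a, d) \<in> acc M RBox" "independence_witness M A B b c d"
      by (rule independenceE)
    then show ?thesis
      by (intro exI[of _ "Some d"])
        (simp add: Some bc split_option_all independence_witness_def)
  qed
qed

lemma xstit_model_add_loop:
  assumes M: "xstit_model M"
  shows "xstit_model (add_loop M)"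
proof -
  note eqv = xstit_modelD(3)[OF M] and sub = xstit_modelD(1)[OF M, rule_format]
    and val = xstit_modelD(2)[OF M, rule_format] and ser = xstit_modelD(4)[OF M, rule_format]
    and det = xstit_modelD(5)[OF M] and empty = xstit_modelD(6)[OF M]
    and Ag = xstit_modelD(7)[OF M] and mono = xstit_modelD(8)[OF M, rule_format]
    and ind = xstit_modelD(9)[OF M]
  have sub': "acc (add_loop M) r \<subseteq> worlds (add_loop M) \<times> worlds (add_loop M)" for r
    using sub[of r] by (auto simp: add_loop_def)
  \<comment> \<open>Paths never mix \<open>None\<close> with old worlds, so composition can be
    computed on each side; this yields both effectivity equations.\<close>
  have comp: "acc (add_loop M) r = acc (add_loop M) s O acc (add_loop M) s'"
    if "acc M r = acc M s O acc M s'" for r s s'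
    using that by (auto simp: set_eq_iff relcomp_unfold split_option_all split_option_ex)
  have "equiv (worlds (add_loop M)) (acc (add_loop M) RBox)"
  proof (rule equivI)
    show "refl_on (worlds (add_loop M)) (acc (add_loop M) RBox)"
    proof (rule refl_onI)
      fix w assume "w \<in> worlds (add_loop M)"
      then show "(w, w) \<in> acc (add_loop M) RBox"
        using eqv by (cases w) (auto simp: refl_on_def equiv_def)
    qed
    show "sym (acc (add_loop M) RBox)"
      using eqv by (auto simp: sym_def equiv_def split_option_all)
    show "trans (acc (add_loop M) RBox)"
      using eqv unfolding trans_def equiv_def split_option_all by simp
  qed (rule sub')
  moreover have "single_valued (acc (add_loop M) RX)"
    using det by (auto simp: single_valued_def split_option_all)
  moreover have "acc (add_loop M) (RA A) \<subseteq> acc (add_loop M) (RA B)" if "B \<subseteq> A" for A B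
    using mono[OF that] by (auto simp: add_loop_def)
  moreover have "\<exists>v. (w, v) \<in> acc (add_loop M) RX" if "w \<in> worlds (add_loop M)" for w
    using that ser by (cases w) (auto simp: split_option_ex)
  moreover have "val (add_loop M) p \<subseteq> worlds (add_loop M)" for p
    using val[of p] by (auto simp: add_loop_def)
  moreover have "worlds (add_loop M) \<noteq> {}" by (simp add: add_loop_def)
  ultimately show ?thesis
    unfolding xstit_model_def
    using sub' comp[OF empty] comp[OF Ag] independence_add_loop[OF ind]
    by (intro conjI allI ballI impI)
qed

theorem theorem10:
  fixes \<Gamma> :: "('p::countable, 'a::finite, 'l::countable) sequent"
  assumes "derivable \<Gamma>"
  shows "valid TYPE('w) \<Gamma>"
  unfolding valid_def satisfied_iff_not_refutes
proof (intro allI impI)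
  fix M :: "('w, 'p, 'a) model" and I :: "'l \<Rightarrow> 'w"
  assume M: "xstit_model M" and I: "\<forall>x. I x \<in> worlds M"
  obtain T where T: "locally_correct T" "IOA_condition T" "concl T = \<Gamma>"
    using assms unfolding derivable_def by blast
  have "\<not> refutes (add_loop M) (Some \<circ> I) (concl T)"
  \<comment> \<open>Nothing lies below the endsequent, so every matching \<open>IOA_E\<close> must
    be found inside \<open>T\<close>, as \<open>IOA_condition\<close> guarantees.\<close>
  proof (rule locally_correct_not_refutes[where S = "{}"])
    show "(None, None) \<in> acc (add_loop M) RX" by simp
  next
    fix \<pi> t assume t: "occurs T \<pi> t" "is_IOA_U t"
    show "IOA_E_of t \<in> {} \<or> (\<exists>\<rho>. strict_prefix \<rho> \<pi> \<and> occurs T \<rho> (IOA_E_of t))"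
    proof (cases t)
      case (IOA_U1 A B w1 w2 w3 w4)
      with T(2) t obtain \<sigma> where "IOA_linked T A B w1 w2 w3 w4 \<pi> \<sigma>"
        unfolding IOA_condition_def by blast
      then show ?thesis using IOA_U1 unfolding IOA_linked_def by auto
    next
      case (IOA_U2 A B w1 w2 w3 w4)
      with T(2) t obtain \<sigma> where "IOA_linked T A B w1 w2 w3 w4 \<sigma> \<pi>"
        unfolding IOA_condition_def by blast
      then show ?thesis using IOA_U2 unfolding IOA_linked_def by auto
    qed (use t in auto)
  qed (use T I xstit_model_add_loop[OF M] in auto)
  then show "\<not> refutes M I \<Gamma>" by (simp add: refutes_add_loop T(3))
qed

end
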